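(* Let $x\in(0,1)$ be a noble number, i.e. an irrational whose continued fraction is $x=[n_1,\dots,n_m,1,1,1,\dots]$ for some $m\ge0$ and positive integers $n_1,\dots,n_m$. Then the degree distribution of the Haros graph $G_x$ has an exponential tail with base the reciprocal of the Golden number: there exist $C>0$ and $k_0$ such that $P(k,x)=C\,(\phi^{-1})^{k}$ for all $k\ge k_0$, where $\phi=(1+\sqrt5)/2$.
   Context: Continued fraction: $[a_1,a_2,\dots]=1/(a_1+1/(a_2+\cdots))$. Farey binary tree: level $\ell_1=\{0/1,1/1\}$, $\ell_{n+1}$ consists of mediants $\frac{p+p'}{q+q'}$ of adjacent pairs $p/q<p'/q'$ in $\bigcup_{i\le n}\ell_i$; each reduced $p/q\in(0,1)$ is the mediant of a unique adjacent pair $p_1/q_1<p_2/q_2$ (its parents). The symbolic path of $x=[a_1,a_2,\dots]$ starting at $1/1$ is $L^{a_1}R^{a_2}L^{a_3}\cdots$ ($L$ = go to smaller child, $R$ = larger child; $1/1\to1/2$ is $L$). Haros graphs: $G_0$ has two nodes joined by an edge; for ordered-node graphs $G$ ($v_1,\dots,v_a$) and $G'$ ($w_1,\dots,w_b$), $G\oplus G'$ identifies $v_a$ with $w_1$, keeps all edges, and adds an edge between its first and last node. $G_{0/1}=G_{1/1}=G_0$, $G_{p/q}=G_{p_1/q_1}\oplus G_{p_2/q_2}$. Degree convention: first and last nodes are merged into one boundary node whose degree is the sum of theirs, giving $q$ nodes; $P(k,p/q)$ is the fraction of them with degree $k$. For irrational $x$, $P(k,x)=\lim_j P(k,x_j)$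 along the rationals $x_j$ visited by the symbolic path of $x$. *)

theory Defs
  imports "HOL-Analysis.Analysis"
begin

section \<open>Continued fractions\<close>

fun cf_fin :: "nat list \<Rightarrow> real" where
  "cf_fin [] = 0"
| "cf_fin (a # as) = 1 / (real a + cf_fin as)"

text \<open>Partial quotients are indexed from 0: \<open>a i\<close> is the usual \<open>a\<^bsub>i+1\<^esub>\<close>.\<close>

definition cf_expansion :: "(nat \<Rightarrow> nat) \<Rightarrow> real \<Rightarrow> bool" where
  "cf_expansion a x \<longleftrightarrow>
     (\<forall>i. 0 < a i) \<and> (\<lambda>n. cf_fin (map a [0..<n])) \<longlonglongrightarrow> x"

definition cf_of :: "real \<Rightarrow> nat \<Rightarrow> nat" where
  "cf_of x = (THE a. cf_expansion a x)"

definition noble :: "real \<Rightarrow> bool" where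
  "noble x \<longleftrightarrow> x \<notin> \<rat> \<and> (\<exists>a m. cf_expansion a x \<and> (\<forall>i\<ge>m. a i = 1))"


section \<open>The Farey binary tree\<close>

definition mediant :: "rat \<Rightarrow> rat \<Rightarrow> rat" where
  "mediant r s = Fract (fst (quotient_of r) + fst (quotient_of s))
                       (snd (quotient_of r) + snd (quotient_of s))"

definition adjacent_in :: "rat set \<Rightarrow> rat \<Rightarrow> rat \<Rightarrow> bool" where
  "adjacent_in U r s \<longleftrightarrow> r \<in> U \<and> s \<in> U \<and> r < s \<and> \<not> (\<exists>t\<in>U. r < t \<and> t < s)"

text \<open>Levels are numbered from 1; level 0 is a dummy.\<close>

fun farey_level :: "nat \<Rightarrow> rat set" where
  "farey_level 0 = {}"
| "farey_level (Suc 0) = {0, 1}"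
| "farey_level (Suc (Suc n)) =
     {mediant r s | r s. adjacent_in (\<Union>i\<in>{..Suc n}. farey_level i) r s}"

definition farey_upto :: "nat \<Rightarrow> rat set" where
  "farey_upto n = (\<Union>i\<in>{..n}. farey_level i)"

definition farey_parents :: "rat \<Rightarrow> rat \<Rightarrow> rat \<Rightarrow> bool" where
  "farey_parents r s x \<longleftrightarrow> (\<exists>n. adjacent_in (farey_upto n) r s) \<and> x = mediant r s"

definition smaller_child :: "rat \<Rightarrow> rat" where
  "smaller_child x =
     (THE y. \<exists>n r. x \<in> farey_level n \<and> adjacent_in (farey_upto n) r x \<and> y = mediant r x)"

definition larger_child :: "rat \<Rightarrow> rat" where
  "larger_child x =
     (THE y. \<exists>n s. x \<in> farey_level n \<and> adjacent_in (farey_upto n) x s \<and> y = mediant x s)"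

datatype direction = L | R

text \<open>The \<open>j\<close>-th letter (from 0) of \<open>L\<^bsup>a 0\<^esup> R\<^bsup>a 1\<^esup> L\<^bsup>a 2\<^esup> \<dots>\<close>: the
  \<open>LEAST\<close> expression is the index of the block containing position \<open>j\<close>.\<close>

definition path_letter :: "(nat \<Rightarrow> nat) \<Rightarrow> nat \<Rightarrow> direction" where
  "path_letter a j = (if even (LEAST i. j < (\<Sum>t\<le>i. a t)) then L else R)"

fun farey_path :: "(nat \<Rightarrow> nat) \<Rightarrow> nat \<Rightarrow> rat" where
  "farey_path a 0 = 1"
| "farey_path a (Suc j) =
     (case path_letter a j of
        L \<Rightarrow> smaller_child (farey_path a j)
      | R \<Rightarrow> larger_child (farey_path a j))"

definition symbolic_path :: "real \<Rightarrow> nat \<Rightarrow> rat" where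
  "symbolic_path x = farey_path (cf_of x)"


section \<open>Haros graphs\<close>

text \<open>Nodes, in order, are \<open>0, \<dots>, num_nodes G - 1\<close>; an edge between \<open>i\<close> and \<open>j\<close> is
  the set \<open>{i, j}\<close>.\<close>

record ograph =
  num_nodes :: nat
  edges :: "nat set set"

definition G_zero :: ograph where
  "G_zero = \<lparr>num_nodes = 2, edges = {{0, 1}}\<rparr>"

definition ograph_concat :: "ograph \<Rightarrow> ograph \<Rightarrow> ograph" where
  "ograph_concat G H =
     (let d = num_nodes G - 1; N = num_nodes G + num_nodes H - 1 in
      \<lparr>num_nodes = N,
       edges = edges G \<union> (\<lambda>e. (\<lambda>i. i + d) ` e) ` edges H \<union> {{0, N - 1}}\<rparr>)"

inductive is_haros_graph :: "rat \<Rightarrow> ograph \<Rightarrow> bool" where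
  zero: "is_haros_graph 0 G_zero"
| one: "is_haros_graph 1 G_zero"
| mediant: "farey_parents r s x \<Longrightarrow> is_haros_graph r G \<Longrightarrow> is_haros_graph s H \<Longrightarrow>
     is_haros_graph x (ograph_concat G H)"

definition haros_graph :: "rat \<Rightarrow> ograph" where
  "haros_graph x = (THE G. is_haros_graph x G)"

definition degree :: "ograph \<Rightarrow> nat \<Rightarrow> nat" where
  "degree G v = card {e \<in> edges G. v \<in> e}"

text \<open>After merging, the nodes are \<open>0, \<dots>, num_nodes G - 2\<close>, with \<open>0\<close> the boundary node.\<close>

definition merged_degree :: "ograph \<Rightarrow> nat \<Rightarrow> nat" where
  "merged_degree G v =
     (if v = 0 then degree G 0 + degree G (num_nodes G - 1) else degree G v)"

definition degree_fraction :: "nat \<Rightarrow> ograph \<Rightarrow> real" where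
  "degree_fraction k G =
     real (card {v. v < num_nodes G - 1 \<and> merged_degree G v = k}) / real (num_nodes G - 1)"

definition P_rat :: "nat \<Rightarrow> rat \<Rightarrow> real" where
  "P_rat k r = degree_fraction k (haros_graph r)"

definition P_irrat :: "nat \<Rightarrow> real \<Rightarrow> real" where
  "P_irrat k x = lim (\<lambda>j. P_rat k (symbolic_path x j))"

end

theory Submission
  imports Defs "HOL-Number_Theory.Fib"
begin

text \<open>Concatenating two graphs adds their interior degree counts, creates one new interior node whose
  degree is the last degree of the left graph plus the first degree of the right graph, and raises the
  two outer degrees by one. For a noble number the symbolic path finally alternates between \<open>L\<close> and
  \<open>R\<close>, so that each graph on the path is the concatenation, in one order or the other, of its
  two predecessors. Then the boundary degree grows by exactly one in each step, and the new interior
  node receives the boundary degree of the preceding graph. Hence for large \<open>k\<close> the number of interior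
  nodes of degree \<open>k\<close> is a Fibonacci sequence that starts at a time \<open>k - const\<close>, while the
  total number of nodes obeys the Fibonacci recurrence as well; the quotient tends to a constant times
  \<open>\<phi>\<^bsup>-k\<^esup>\<close>.\<close>

section \<open>Uniqueness of the expansion of an irrational number, by iterating the Gauss
  map\<close>

section \<open>Continued fractions\<close>

lemma cf_fin_nonneg: "0 \<le> cf_fin as"
  by (induction as) auto

lemma cf_fin_le_1: "\<forall>a\<in>set as. 0 < a \<Longrightarrow> cf_fin as \<le> 1"
proof (cases as)
  case (Cons b bs)
  assume "\<forall>a\<in>set as. 0 < a"
  then have "1 \<le> real b" using Cons by (simp add: Suc_leI)
  then show ?thesis using Cons cf_fin_nonneg[of bs] by simp
qed simp

lemma cf_expansion_bounds:
  assumes "cf_expansion a x"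
  shows "0 \<le> x" "x \<le> 1"
proof -
  have lim: "(\<lambda>n. cf_fin (map a [0..<n])) \<longlonglongrightarrow> x" and pos: "\<And>i. 0 < a i"
    using assms by (auto simp: cf_expansion_def)
  show "0 \<le> x"
    by (rule LIMSEQ_le_const[OF lim]) (auto simp: cf_fin_nonneg)
  show "x \<le> 1"
    by (rule LIMSEQ_le_const2[OF lim], intro exI allI impI cf_fin_le_1) (simp add: pos)
qed

text \<open>Inverting a nonempty finite continued fraction and subtracting its first entry deletes
  that entry. Since \<open>x \<noteq> 0\<close>, this passes to the limit, so shifting the quotients
  is the Gauss map.\<close>

lemma cf_expansion_tail:
  assumes "cf_expansion a x" and "x \<noteq> 0"
  shows "cf_expansion (a \<circ> Suc) (1 / x - real (a 0))"
proof -
  have lim: "(\<lambda>n. cf_fin (map a [0..<n])) \<longlonglongrightarrow> x" and pos: "\<And>i. 0 < a i"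
    using assms by (auto simp: cf_expansion_def)
  have "(\<lambda>n. 1 / cf_fin (map a [0..<Suc n]) - real (a 0)) \<longlonglongrightarrow> 1 / x - real (a 0)"
    by (intro tendsto_intros LIMSEQ_Suc lim assms(2))
  moreover have "1 / cf_fin (map a [0..<Suc n]) - real (a 0) = cf_fin (map (a \<circ> Suc) [0..<n])" for n
  proof -
    have "map a [0..<Suc n] = a 0 # map (a \<circ> Suc) [0..<n]"
      by (simp add: map_upt_Suc comp_def del: upt_Suc)
    then show ?thesis
      using cf_fin_nonneg[of "map (a \<circ> Suc) [0..<n]"] pos[of 0] by simp
  qed
  ultimately show ?thesis
    by (simp add: cf_expansion_def pos)
qed

lemma cf_expansion_tail_irrat:
  assumes "x \<notin> \<rat>"
  shows "1 / x - real n \<notin> \<rat>"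
proof
  assume "1 / x - real n \<in> \<rat>"
  then have "1 / (1 / x - real n + real n) \<in> \<rat>"
    by (intro Rats_divide Rats_add) auto
  then show False using assms by simp
qed

text \<open>The remainder \<open>1 / x - a 0\<close> is itself an expansion limit, so it lies in
  [0,1]; being irrational, it is not 1.\<close>

lemma cf_expansion_first:
  assumes "cf_expansion a x" and "x \<notin> \<rat>"
  shows "int (a 0) = \<lfloor>1 / x\<rfloor>"
proof -
  have "x \<noteq> 0" using assms(2) by auto
  then have tail: "cf_expansion (a \<circ> Suc) (1 / x - real (a 0))"
    by (rule cf_expansion_tail[OF assms(1)])
  have "1 / x - real (a 0) \<noteq> 1"
    using cf_expansion_tail_irrat[OF assms(2), of "a 0"] by (metis Rats_1)
  with cf_expansion_bounds[OF tail] show ?thesis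
    by linarith
qed

text \<open>The floor fixes the first quotient, and the shifted sequences expand the same irrational
  remainder. Hence the description in \<open>cf_of\<close> denotes.\<close>

lemma cf_expansion_unique:
  assumes "cf_expansion a x" and "cf_expansion b x" and "x \<notin> \<rat>"
  shows "a = b"
proof
  fix n show "a n = b n"
    using assms
  proof (induction n arbitrary: a b x)
    case 0
    then show ?case using cf_expansion_first by (metis of_nat_eq_iff)
  next
    case (Suc n)
    have nz: "x \<noteq> 0" using Suc.prems(3) by auto
    have eq: "a 0 = b 0" using Suc.prems cf_expansion_first by (metis of_nat_eq_iff)
    have "(a \<circ> Suc) n = (b \<circ> Suc) n"
    proof (rule Suc.IH)
      show "cf_expansion (a \<circ> Suc) (1 / x - real (a 0))"
        using cf_expansion_tail nz Suc.prems by blast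
      show "cf_expansion (b \<circ> Suc) (1 / x - real (a 0))"
        using cf_expansion_tail nz Suc.prems eq by metis
      show "1 / x - real (a 0) \<notin> \<rat>"
        using cf_expansion_tail_irrat Suc.prems by blast
    qed
    then show ?case by simp
  qed
qed

lemma cf_of_eq:
  assumes "cf_expansion a x" and "x \<notin> \<rat>"
  shows "cf_of x = a"
  unfolding cf_of_def using assms cf_expansion_unique by blast


section \<open>Mediants, levels, and the gaps between adjacent fractions\<close>

section \<open>The Farey tree\<close>

lemma mediant_between:
  assumes "r < s"
  shows "r < mediant r s" and "mediant r s < s"
proof -
  obtain p q where r: "quotient_of r = (p, q)" by force
  obtain p' q' where s: "quotient_of s = (p', q')" by force
  have pos: "0 < q" "0 < q'" using r s quotient_of_denom_pos by blast+
  have rs: "r = of_int p / of_int q" "s = of_int p' / of_int q'"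
    using r s quotient_of_div by blast+
  have m: "mediant r s = (of_int p + of_int p') / (of_int q + of_int q')"
    by (simp add: mediant_def r s Fract_of_int_quotient)
  have posr: "0 < (of_int q :: rat)" "0 < (of_int q' :: rat)" using pos by simp_all
  have less: "(of_int p :: rat) * of_int q' < of_int p' * of_int q"
    using assms posr unfolding rs by (simp add: divide_less_eq less_divide_eq field_simps)
  have "of_int p / of_int q < ((of_int p + of_int p') / (of_int q + of_int q') :: rat)"
    "((of_int p + of_int p') / (of_int q + of_int q') :: rat) < of_int p' / of_int q'"
    using less posr by (simp_all add: field_simps add_pos_pos)
  then show "r < mediant r s" "mediant r s < s"
    by (simp_all only: m, simp_all only: rs)
qed

lemma farey_upto_mono: "m \<le> n \<Longrightarrow> farey_upto m \<subseteq> farey_upto n"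
  by (force simp: farey_upto_def)

lemma farey_level_subset_upto: "farey_level n \<subseteq> farey_upto n"
  by (auto simp: farey_upto_def)

lemma farey_upto_0: "farey_upto 0 = {}"
  by (simp add: farey_upto_def)

lemma farey_upto_1: "farey_upto (Suc 0) = {0, 1}"
  by (auto simp: farey_upto_def le_Suc_eq)

text \<open>For \<open>n = 0\<close> this fails: level 1 is prescribed, while the dummy level 0 has
  no adjacent pairs.\<close>

lemma farey_level_Suc:
  assumes "0 < n"
  shows "farey_level (Suc n) = {mediant r s | r s. adjacent_in (farey_upto n) r s}"
  using assms by (cases n) (simp_all add: farey_upto_def)

declare farey_level.simps(3) [simp del] farey_path.simps(2) [simp del]

lemma farey_upto_Suc: "farey_upto (Suc n) = farey_upto n \<union> farey_level (Suc n)"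
  by (auto simp: farey_upto_def le_Suc_eq)

lemma adjacent_in_upto_pos: "adjacent_in (farey_upto n) r s \<Longrightarrow> 0 < n"
  by (cases n) (auto simp: adjacent_in_def farey_upto_0)

lemma mediant_in_level:
  "adjacent_in (farey_upto n) r s \<Longrightarrow> mediant r s \<in> farey_level (Suc n)"
  using adjacent_in_upto_pos farey_level_Suc by blast

lemma mediant_notin_upto:
  "adjacent_in (farey_upto n) r s \<Longrightarrow> mediant r s \<notin> farey_upto n"
  unfolding adjacent_in_def using mediant_between by blast

lemma farey_level_notin_upto:
  assumes "x \<in> farey_level (Suc n)"
  shows "x \<notin> farey_upto n"
proof (cases n)
  case (Suc m)
  then obtain r s where "adjacent_in (farey_upto n) r s" "x = mediant r s"
    using assms farey_level_Suc[of n] by auto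
  then show ?thesis using mediant_notin_upto by blast
qed (simp add: farey_upto_0)

text \<open>A new mediant lies strictly inside a gap of all earlier levels, so levels are disjoint
  and each fraction has a single birth level.\<close>

lemma farey_level_unique:
  assumes "x \<in> farey_level m" and "x \<in> farey_level n"
  shows "m = n"
proof -
  have "\<not> m < n" if "x \<in> farey_level m" "x \<in> farey_level n" for m n
  proof
    assume "m < n"
    then obtain k where k: "n = Suc k" "m \<le> k" by (cases n) auto
    then have "x \<in> farey_upto k"
      using that(1) farey_level_subset_upto farey_upto_mono by blast
    then show False using that(2) k farey_level_notin_upto by blast
  qed
  then show ?thesis using assms by (meson linorder_neqE_nat)
qed

lemma adjacent_in_unique:
  assumes "adjacent_in U r s" and "adjacent_in U r' s'"
    and "r < x" "x < s" "r' < x" "x < s'"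
  shows "r = r'" and "s = s'"
  using assms unfolding adjacent_in_def by (meson less_trans linorder_neqE)+

text \<open>A new fraction in the gap is the mediant of some gap containing it. Distinct gaps do not
  overlap, so each gap receives exactly one new fraction.\<close>

lemma adjacent_in_Suc:
  assumes adj: "adjacent_in (farey_upto n) r s"
  shows "adjacent_in (farey_upto (Suc n)) r (mediant r s)"
    and "adjacent_in (farey_upto (Suc n)) (mediant r s) s"
proof -
  let ?m = "mediant r s"
  have rs: "r \<in> farey_upto n" "s \<in> farey_upto n" "r < s"
    using adj by (auto simp: adjacent_in_def)
  have new: "t = ?m" if t: "t \<in> farey_upto (Suc n)" "r < t" "t < s" for t
  proof -
    have "t \<in> farey_level (Suc n)"
      using t adj by (auto simp: farey_upto_Suc adjacent_in_def)
    then obtain r' s' where rs': "adjacent_in (farey_upto n) r' s'" "t = mediant r' s'"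
      using farey_level_Suc adjacent_in_upto_pos[OF adj] by blast
    then have "r' < t" "t < s'" using mediant_between by (auto simp: adjacent_in_def)
    then show ?thesis
      using adjacent_in_unique[OF adj rs'(1)] t rs'(2) by blast
  qed
  have "?m \<in> farey_upto (Suc n)" using mediant_in_level[OF adj] by (simp add: farey_upto_Suc)
  moreover have "r \<in> farey_upto (Suc n)" "s \<in> farey_upto (Suc n)"
    using rs by (simp_all add: farey_upto_Suc)
  ultimately show "adjacent_in (farey_upto (Suc n)) r ?m" "adjacent_in (farey_upto (Suc n)) ?m s"
    unfolding adjacent_in_def using new mediant_between[OF rs(3)]
    by (metis less_irrefl less_trans)+
qed

section \<open>Children and parents are well defined\<close>

lemma smaller_child_eq:
  assumes "x \<in> farey_level n" and "adjacent_in (farey_upto n) r x"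
  shows "smaller_child x = mediant r x"
  unfolding smaller_child_def
proof (rule the_equality)
  fix y assume "\<exists>n r. x \<in> farey_level n \<and> adjacent_in (farey_upto n) r x \<and> y = mediant r x"
  then obtain n' r' where *: "x \<in> farey_level n'" "adjacent_in (farey_upto n') r' x" "y = mediant r' x"
    by blast
  then have "n' = n" using farey_level_unique assms(1) by blast
  then have "r' = r" using * assms(2) unfolding adjacent_in_def by (metis linorder_neqE)
  then show "y = mediant r x" using * by simp
qed (use assms in blast)

lemma larger_child_eq:
  assumes "x \<in> farey_level n" and "adjacent_in (farey_upto n) x s"
  shows "larger_child x = mediant x s"
  unfolding larger_child_def
proof (rule the_equality)
  fix y assume "\<exists>n s. x \<in> farey_level n \<and> adjacent_in (farey_upto n) x s \<and> y = mediant x s"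
  then obtain n' s' where *: "x \<in> farey_level n'" "adjacent_in (farey_upto n') x s'" "y = mediant x s'"
    by blast
  then have "n' = n" using farey_level_unique assms(1) by blast
  then have "s' = s" using * assms(2) unfolding adjacent_in_def by (metis linorder_neqE)
  then show "y = mediant x s" using * by simp
qed (use assms in blast)

lemma farey_parents_level:
  assumes "farey_parents r s x"
  obtains n where "0 < n" "adjacent_in (farey_upto n) r s" "x \<in> farey_level (Suc n)"
  using assms mediant_in_level adjacent_in_upto_pos unfolding farey_parents_def by blast

text \<open>The birth level of \<open>x\<close> fixes the level of the gap, and \<open>x\<close>
  itself then fixes the gap.\<close>

lemma farey_parents_unique:
  assumes "farey_parents r s x" and "farey_parents r' s' x"
  shows "r = r'" and "s = s'"
proof -
  obtain n where n: "adjacent_in (farey_upto n) r s" "x \<in> farey_level (Suc n)"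
    using assms(1) farey_parents_level by blast
  obtain n' where n': "adjacent_in (farey_upto n') r' s'" "x \<in> farey_level (Suc n')"
    using assms(2) farey_parents_level by blast
  have "n' = n" using n(2) n'(2) farey_level_unique by blast
  moreover have "r < x" "x < s" "r' < x" "x < s'"
    using assms n(1) n'(1) mediant_between[of r s] mediant_between[of r' s']
    by (simp_all add: farey_parents_def adjacent_in_def)
  ultimately show "r = r'" "s = s'" using adjacent_in_unique n n' by metis+
qed

text \<open>Mediants of adjacent pairs are born at level 2 or later. This separates the base clauses
  of \<open>is_haros_graph\<close> from the recursive one.\<close>

lemma not_farey_parents_01: "\<not> farey_parents r s 0" "\<not> farey_parents r s 1"
proof -
  have "\<not> farey_parents r s x" if "x \<in> farey_level (Suc 0)" for x
    using that farey_level_unique farey_parents_level by (metis Suc_inject less_nat_zero_code)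
  then show "\<not> farey_parents r s 0" "\<not> farey_parents r s 1" by auto
qed

text \<open>The neighbours of \<open>farey_path a j\<close> among the fractions of level at most \<open>j + 1\<close>. The value
  at \<open>0\<close> of \<open>right_neighbour\<close> is a dummy, since \<open>1\<close> has no right neighbour.\<close>

primrec left_neighbour :: "(nat \<Rightarrow> nat) \<Rightarrow> nat \<Rightarrow> rat" where
  "left_neighbour a 0 = 0"
| "left_neighbour a (Suc j) =
     (case path_letter a j of L \<Rightarrow> left_neighbour a j | R \<Rightarrow> farey_path a j)"

primrec right_neighbour :: "(nat \<Rightarrow> nat) \<Rightarrow> nat \<Rightarrow> rat" where
  "right_neighbour a 0 = 1"
| "right_neighbour a (Suc j) =
     (case path_letter a j of L \<Rightarrow> farey_path a j | R \<Rightarrow> right_neighbour a j)"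

lemma path_letter_0: "0 < a 0 \<Longrightarrow> path_letter a 0 = L"
proof -
  assume "0 < a 0"
  then have "(LEAST i. 0 < (\<Sum>t\<le>i. a t)) = 0" by (intro Least_equality) auto
  then show ?thesis by (simp add: path_letter_def)
qed

text \<open>Induction along the path: going to a child keeps the neighbour on that side, and the
  vertex just left becomes the neighbour on the other side.\<close>

lemma farey_path_neighbours:
  assumes "path_letter a 0 = L"
  shows "farey_path a j \<in> farey_level (Suc j)"
    and "adjacent_in (farey_upto (Suc j)) (left_neighbour a j) (farey_path a j)"
    and "0 < j \<Longrightarrow> adjacent_in (farey_upto (Suc j)) (farey_path a j) (right_neighbour a j)"
proof -
  have "farey_path a j \<in> farey_level (Suc j) \<and>
    adjacent_in (farey_upto (Suc j)) (left_neighbour a j) (farey_path a j) \<and>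
    (0 < j \<longrightarrow> adjacent_in (farey_upto (Suc j)) (farey_path a j) (right_neighbour a j))"
  proof (induction j)
    case 0
    show ?case by (auto simp: adjacent_in_def farey_upto_1)
  next
    case (Suc j)
    show ?case
    proof (cases "path_letter a j")
      case L
      have "farey_path a (Suc j) = mediant (left_neighbour a j) (farey_path a j)"
        using Suc L smaller_child_eq[of _ "Suc j"] by (simp add: farey_path.simps)
      then show ?thesis
        using Suc L adjacent_in_Suc mediant_in_level by simp
    next
      case R
      \<comment> \<open>The root has no right neighbour, but the first letter is \<open>L\<close>,
        so an \<open>R\<close> cannot occur there.\<close>
      then have "0 < j" using assms by (cases j) auto
      with Suc R have "farey_path a (Suc j) = mediant (farey_path a j) (right_neighbour a j)"
        using larger_child_eq[of _ "Suc j"] by (simp add: farey_path.simps)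
      then show ?thesis
        using Suc R \<open>0 < j\<close> adjacent_in_Suc mediant_in_level
        by simp
    qed
  qed
  then show "farey_path a j \<in> farey_level (Suc j)"
    and "adjacent_in (farey_upto (Suc j)) (left_neighbour a j) (farey_path a j)"
    and "0 < j \<Longrightarrow> adjacent_in (farey_upto (Suc j)) (farey_path a j) (right_neighbour a j)"
    by blast+
qed

lemma farey_path_Suc_L:
  assumes "path_letter a 0 = L" and "path_letter a j = L"
  shows "farey_path a (Suc j) = mediant (left_neighbour a j) (farey_path a j)"
  using assms smaller_child_eq[OF farey_path_neighbours(1,2)] by (simp add: farey_path.simps)

lemma farey_path_Suc_R:
  assumes "path_letter a 0 = L" and "path_letter a j = R"
  shows "0 < j" and "farey_path a (Suc j) = mediant (farey_path a j) (right_neighbour a j)"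
proof -
  show "0 < j" using assms by (cases j) auto
  then show "farey_path a (Suc j) = mediant (farey_path a j) (right_neighbour a j)"
    using assms larger_child_eq[OF farey_path_neighbours(1,3)] by (simp add: farey_path.simps)
qed

text \<open>From position \<open>\<Sum>t<m. a t\<close> on, every block has length one, so position
  \<open>u\<close> of the tail is the whole block \<open>m + u\<close>.\<close>

lemma path_letter_tail:
  assumes "\<And>i. m \<le> i \<Longrightarrow> a i = 1"
  shows "path_letter a ((\<Sum>t<m. a t) + u) = (if even (m + u) then L else R)"
proof -
  let ?S = "\<Sum>t<m. a t"
  have sum: "(\<Sum>t<m + v. a t) = ?S + v" for v
    by (induction v) (auto simp: assms)
  have "(LEAST i. ?S + u < (\<Sum>t\<le>i. a t)) = m + u"
  proof (rule Least_equality)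
    show "?S + u < (\<Sum>t\<le>m + u. a t)"
      using sum[of "Suc u"] by (simp add: lessThan_Suc_atMost)
    fix i assume i: "?S + u < (\<Sum>t\<le>i. a t)"
    show "m + u \<le> i"
    proof (rule ccontr)
      assume "\<not> m + u \<le> i"
      then have "(\<Sum>t\<le>i. a t) \<le> (\<Sum>t<m + u. a t)"
        by (intro sum_mono2) auto
      then show False using i sum[of u] by simp
    qed
  qed
  then show ?thesis by (simp add: path_letter_def)
qed


section \<open>Effect of concatenation on end degrees and interior degree counts\<close>

section \<open>Degrees in concatenated graphs\<close>

text \<open>This keeps the two end nodes distinct and ensures that two graphs glued at one node
  share no edge.\<close>

definition wf_ograph :: "ograph \<Rightarrow> bool" where
  "wf_ograph G \<longleftrightarrow> 2 \<le> num_nodes G \<and> (\<forall>e\<in>edges G. e \<subseteq> {..<num_nodes G} \<and> card e = 2)"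

definition first_degree :: "ograph \<Rightarrow> nat" where
  "first_degree G = degree G 0"

definition last_degree :: "ograph \<Rightarrow> nat" where
  "last_degree G = degree G (num_nodes G - 1)"

text \<open>The ends are left out because later concatenations change their degrees; interior
  degrees are final.\<close>

definition interior_count :: "nat \<Rightarrow> ograph \<Rightarrow> nat" where
  "interior_count k G = card {v. 0 < v \<and> v < num_nodes G - 1 \<and> degree G v = k}"

lemma wf_ograph_finite_edges: "wf_ograph G \<Longrightarrow> finite (edges G)"
  by (rule finite_subset[of _ "Pow {..<num_nodes G}"]) (auto simp: wf_ograph_def)

lemma wf_G_zero: "wf_ograph G_zero"
  by (simp add: wf_ograph_def G_zero_def)

lemma num_nodes_concat:
  "num_nodes (ograph_concat G H) = num_nodes G + num_nodes H - 1"
  by (simp add: ograph_concat_def Let_def)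

lemma wf_ograph_concat:
  assumes "wf_ograph G" and "wf_ograph H"
  shows "wf_ograph (ograph_concat G H)"
proof -
  have n: "2 \<le> num_nodes G" "2 \<le> num_nodes H"
    using assms by (auto simp: wf_ograph_def)
  have "e \<subseteq> {..<num_nodes G + num_nodes H - 1} \<and> card e = 2"
    if "e \<in> edges (ograph_concat G H)" for e
  proof -
    consider "e \<in> edges G" | f where "f \<in> edges H" "e = (\<lambda>i. i + (num_nodes G - 1)) ` f"
      | "e = {0, num_nodes G + num_nodes H - 1 - 1}"
      using \<open>e \<in> _\<close> by (auto simp: ograph_concat_def Let_def)
    then show ?thesis
    proof cases
      case 1
      then have "e \<subseteq> {..<num_nodes G}" "card e = 2" using assms by (auto simp: wf_ograph_def)
      then show ?thesis using n by fastforce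
    next
      case 2
      then have f: "f \<subseteq> {..<num_nodes H}" "card f = 2" using assms by (auto simp: wf_ograph_def)
      have "card e = 2" using f 2 by (simp add: card_image)
      then show ?thesis using f 2 n by fastforce
    next
      case 3
      then show ?thesis using n by simp
    qed
  qed
  then show ?thesis using n by (simp add: wf_ograph_def num_nodes_concat)
qed

lemma degree_ge_num_nodes: "wf_ograph G \<Longrightarrow> num_nodes G \<le> v \<Longrightarrow> degree G v = 0"
  unfolding degree_def wf_ograph_def
  by (metis (no_types, lifting) card.empty empty_Collect_eq lessThan_iff not_le subsetD)

text \<open>The edges split into three disjoint families: those of \<open>G\<close>, the shifted
  ones of \<open>H\<close>, and the new outer edge. The test \<open>d \<le> v\<close> guards the
  truncated subtraction.\<close>

lemma degree_concat:
  assumes "wf_ograph G" and "wf_ograph H"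
  defines "d \<equiv> num_nodes G - 1" and "N \<equiv> num_nodes G + num_nodes H - 1"
  shows "degree (ograph_concat G H) v =
    degree G v + (if d \<le> v then degree H (v - d) else 0) + (if v = 0 \<or> v = N - 1 then 1 else 0)"
proof -
  let ?sh = "\<lambda>e. (\<lambda>i. i + d) ` e"
  define A where "A = {e \<in> edges G. v \<in> e}"
  define B where "B = {e \<in> ?sh ` edges H. v \<in> e}"
  define C where "C = {e. e = {0, N - 1} \<and> v \<in> e}"
  have n: "2 \<le> num_nodes G" "2 \<le> num_nodes H"
    using assms by (auto simp: wf_ograph_def)
  have G: "e \<subseteq> {..d}" "card e = 2" if "e \<in> edges G" for e
    using that assms(1) n unfolding wf_ograph_def d_def by fastforce+
  have H: "e \<subseteq> {d..}" "card e = 2" if "e \<in> ?sh ` edges H" for e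
    using that assms(2) unfolding wf_ograph_def by (auto simp: card_image)
  have "finite A" "finite B" "finite C"
    using assms(1,2) wf_ograph_finite_edges by (auto simp: A_def B_def C_def)
  moreover have "A \<inter> B = {}"
  proof -
    have False if "e \<in> edges G" "e \<in> ?sh ` edges H" for e
    proof -
      \<comment> \<open>The halves meet only in node \<open>d\<close>, too small to carry an
        edge.\<close>
      have "e \<subseteq> {d}" using G(1)[OF that(1)] H(1)[OF that(2)] by fastforce
      then have "card e \<le> card {d}" by (intro card_mono) auto
      then show False using G(2)[OF that(1)] by simp
    qed
    then show ?thesis unfolding A_def B_def by blast
  qed
  moreover have "(A \<union> B) \<inter> C = {}"
  proof -
    \<comment> \<open>Since \<open>0 < d\<close> and \<open>d < N - 1\<close>, the outer edge leaves
      both halves.\<close>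
    have "\<not> {0, N - 1} \<subseteq> {..d}" "\<not> {0, N - 1} \<subseteq> {d..}" using n by (auto simp: N_def d_def)
    then show ?thesis using G(1) H(1) unfolding A_def B_def C_def by blast
  qed
  moreover have "{e \<in> edges (ograph_concat G H). v \<in> e} = A \<union> B \<union> C"
    by (auto simp: ograph_concat_def Let_def A_def B_def C_def d_def N_def)
  ultimately have "degree (ograph_concat G H) v = card A + card B + card C"
    unfolding degree_def by (simp add: card_Un_disjoint)
  moreover have "card B = (if d \<le> v then degree H (v - d) else 0)"
  proof (cases "d \<le> v")
    case True
    have "inj ?sh" by (simp add: inj_image_eq_iff inj_def)
    moreover have "B = ?sh ` {e \<in> edges H. v - d \<in> e}"
      using True unfolding B_def by force
    ultimately show ?thesis
      using True by (simp add: degree_def card_image inj_on_subset)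
  next
    case False
    then have "B = {}" unfolding B_def by auto
    then show ?thesis using False by simp
  qed
  moreover have "C = (if v = 0 \<or> v = N - 1 then {{0, N - 1}} else {})"
    by (auto simp: C_def)
  moreover have "card A = degree G v"
    by (simp add: A_def degree_def)
  ultimately show ?thesis by simp
qed

lemma first_degree_concat:
  assumes "wf_ograph G" and "wf_ograph H"
  shows "first_degree (ograph_concat G H) = first_degree G + 1"
  using assms degree_concat[OF assms] by (auto simp: first_degree_def wf_ograph_def)

lemma last_degree_concat:
  assumes "wf_ograph G" and "wf_ograph H"
  shows "last_degree (ograph_concat G H) = last_degree H + 1"
proof -
  have n: "2 \<le> num_nodes G" "2 \<le> num_nodes H"
    using assms by (auto simp: wf_ograph_def)
  have "num_nodes G \<le> num_nodes G + num_nodes H - 1 - 1" using n by simp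
  moreover have "num_nodes G + num_nodes H - 1 - 1 - (num_nodes G - 1) = num_nodes H - 1"
    using n by simp
  ultimately show ?thesis
    using degree_concat[OF assms] degree_ge_num_nodes[OF assms(1)] n
    by (simp add: last_degree_def num_nodes_concat)
qed

text \<open>Interior nodes of both parts keep their degrees, as the outer edge touches only the
  ends. The one new interior node is \<open>d\<close>, where an end of each part is merged.\<close>

lemma interior_count_concat:
  assumes "wf_ograph G" and "wf_ograph H"
  shows "interior_count k (ograph_concat G H) =
    interior_count k G + interior_count k H + (if k = last_degree G + first_degree H then 1 else 0)"
proof -
  define d where "d = num_nodes G - 1"
  define b where "b = num_nodes H - 1"
  have n: "2 \<le> num_nodes G" "2 \<le> num_nodes H"
    using assms by (auto simp: wf_ograph_def)
  have pos: "0 < d" "0 < b" using n by (auto simp: d_def b_def)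
  have N: "num_nodes G + num_nodes H - 1 - 1 = d + b" using n by (simp add: d_def b_def)
  let ?K = "ograph_concat G H"
  have deg: "degree ?K v = degree G v + (if d \<le> v then degree H (v - d) else 0)
      + (if v = 0 \<or> v = d + b then 1 else 0)" for v
    using degree_concat[OF assms, of v] by (simp only: N d_def[symmetric])
  have big: "degree G v = 0" if "d < v" for v
    using degree_ge_num_nodes[OF assms(1)] that n by (simp add: d_def)
  have left: "degree ?K v = degree G v" if "0 < v" "v < d" for v
    using that by (simp add: deg)
  have mid: "degree ?K d = last_degree G + first_degree H"
    using pos by (simp add: deg last_degree_def first_degree_def d_def)
  have right: "degree ?K (v + d) = degree H v" if "0 < v" "v < b" for v
    using that big[of "v + d"] by (simp add: deg)
  define A where "A = {v. 0 < v \<and> v < d \<and> degree G v = k}"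
  define B where "B = {v. 0 < v \<and> v < b \<and> degree H v = k}"
  define C where "C = {v. v = d \<and> k = last_degree G + first_degree H}"
  have "{v. 0 < v \<and> v < d + b \<and> degree ?K v = k} = A \<union> (\<lambda>v. v + d) ` B \<union> C"
  proof (intro set_eqI iffI)
    fix v assume v: "v \<in> {v. 0 < v \<and> v < d + b \<and> degree ?K v = k}"
    consider "v < d" | "v = d" | u where "v = u + d" "0 < u"
      by (metis add.commute less_imp_add_positive linorder_neqE_nat)
    then show "v \<in> A \<union> (\<lambda>v. v + d) ` B \<union> C"
      using v left mid right by cases (auto simp: A_def B_def C_def)
  next
    fix v assume "v \<in> A \<union> (\<lambda>v. v + d) ` B \<union> C"
    then show "v \<in> {v. 0 < v \<and> v < d + b \<and> degree ?K v = k}"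
      using left mid right pos by (auto simp: A_def B_def C_def)
  qed
  moreover have "num_nodes ?K - 1 = d + b" by (simp only: num_nodes_concat N)
  moreover have "finite A" "finite B" "finite C" by (auto simp: A_def B_def C_def)
  moreover have "A \<inter> (\<lambda>v. v + d) ` B = {}" "(A \<union> (\<lambda>v. v + d) ` B) \<inter> C = {}"
    by (auto simp: A_def B_def C_def)
  ultimately have "interior_count k ?K = card A + card ((\<lambda>v. v + d) ` B) + card C"
    unfolding interior_count_def by (simp add: card_Un_disjoint)
  moreover have "card ((\<lambda>v. v + d) ` B) = card B" by (simp add: card_image)
  moreover have "C = (if k = last_degree G + first_degree H then {d} else {})"
    by (auto simp: C_def)
  moreover have "card A = interior_count k G" "card B = interior_count k H"
    by (simp_all add: A_def B_def interior_count_def d_def b_def)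
  ultimately show ?thesis by simp
qed

lemma degree_fraction_eq:
  assumes "wf_ograph G"
  shows "degree_fraction k G =
    real (interior_count k G + (if k = first_degree G + last_degree G then 1 else 0))
      / real (num_nodes G - 1)"
proof -
  let ?n = "num_nodes G - 1"
  let ?A = "{v. 0 < v \<and> v < ?n \<and> degree G v = k}"
  let ?B = "if k = first_degree G + last_degree G then {0::nat} else {}"
  have "0 < ?n" using assms by (simp add: wf_ograph_def)
  then have "{v. v < ?n \<and> merged_degree G v = k} = ?A \<union> ?B"
    by (auto simp: merged_degree_def first_degree_def last_degree_def split: if_splits)
  moreover have "card (?A \<union> ?B) = card ?A + card ?B" by (intro card_Un_disjoint) auto
  ultimately show ?thesis by (simp add: degree_fraction_def interior_count_def)
qed

text \<open>A crude bound, enough to make the initial counts vanish for large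
  \<open>k\<close>.\<close>

lemma interior_count_eq_0:
  assumes "wf_ograph G" and "card (edges G) < k"
  shows "interior_count k G = 0"
proof -
  have "degree G v \<le> card (edges G)" for v
    unfolding degree_def by (intro card_mono wf_ograph_finite_edges assms) auto
  then have "{v. 0 < v \<and> v < num_nodes G - 1 \<and> degree G v = k} = {}"
    using assms(2) by (metis (mono_tags, lifting) empty_Collect_eq not_le)
  then show ?thesis by (simp add: interior_count_def)
qed


section \<open>Existence and uniqueness of Haros graphs; recurrences along alternating paths\<close>

section \<open>Haros graphs along a Farey path\<close>

text \<open>Rule inversion on the second derivation: the endpoints have no parents, and every other
  fraction has only one pair of them.\<close>

lemma is_haros_graph_unique:
  assumes "is_haros_graph x G" and "is_haros_graph x G'"
  shows "G = G'"
  using assms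
proof (induction arbitrary: G' rule: is_haros_graph.induct)
  case zero
  then show ?case by (cases rule: is_haros_graph.cases) (auto simp: not_farey_parents_01)
next
  case one
  then show ?case by (cases rule: is_haros_graph.cases) (auto simp: not_farey_parents_01)
next
  case (mediant r s x G H)
  from mediant.prems show ?case
  proof (cases rule: is_haros_graph.cases)
    case (mediant r' s' G'' H'')
    then have "r' = r" "s' = s"
      using farey_parents_unique \<open>farey_parents r s x\<close> by blast+
    then show ?thesis using mediant mediant.IH by blast
  qed (use mediant.hyps not_farey_parents_01 in auto)
qed

lemma is_haros_graph_ex:
  assumes "x \<in> farey_upto n"
  shows "\<exists>G. is_haros_graph x G"
  using assms
proof (induction n arbitrary: x)
  case 0
  then show ?case by (simp add: farey_upto_0)
next
  case (Suc n)
  show ?case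
  proof (cases "n = 0")
    case True
    then show ?thesis using Suc.prems is_haros_graph.zero is_haros_graph.one
      by (auto simp: farey_upto_1)
  next
    case False
    show ?thesis
    proof (cases "x \<in> farey_upto n")
      case False
      then obtain r s where rs: "adjacent_in (farey_upto n) r s" "x = mediant r s"
        using Suc.prems farey_level_Suc \<open>n \<noteq> 0\<close> by (auto simp: farey_upto_Suc)
      then have "farey_parents r s x" by (auto simp: farey_parents_def)
      moreover have "r \<in> farey_upto n" "s \<in> farey_upto n" using rs by (auto simp: adjacent_in_def)
      ultimately show ?thesis using Suc.IH is_haros_graph.mediant by meson
    qed (use Suc.IH in blast)
  qed
qed

lemma haros_graph_eq: "is_haros_graph x G \<Longrightarrow> haros_graph x = G"
  unfolding haros_graph_def using is_haros_graph_unique by blast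

lemma is_haros_graph_haros_graph:
  "x \<in> farey_upto n \<Longrightarrow> is_haros_graph x (haros_graph x)"
  using is_haros_graph_ex haros_graph_eq by metis

lemma haros_graph_mediant:
  assumes "adjacent_in (farey_upto n) r s"
  shows "haros_graph (mediant r s) = ograph_concat (haros_graph r) (haros_graph s)"
proof (rule haros_graph_eq, rule is_haros_graph.mediant)
  show "farey_parents r s (mediant r s)" using assms by (auto simp: farey_parents_def)
  show "is_haros_graph r (haros_graph r)" "is_haros_graph s (haros_graph s)"
    using assms is_haros_graph_haros_graph by (auto simp: adjacent_in_def)
qed

lemma wf_is_haros_graph: "is_haros_graph x G \<Longrightarrow> wf_ograph G"
  by (induction rule: is_haros_graph.induct) (auto intro: wf_G_zero wf_ograph_concat)

lemma wf_haros_graph: "x \<in> farey_upto n \<Longrightarrow> wf_ograph (haros_graph x)"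
  using is_haros_graph_haros_graph wf_is_haros_graph by blast

abbreviation path_graph :: "(nat \<Rightarrow> nat) \<Rightarrow> nat \<Rightarrow> ograph" where
  "path_graph a j \<equiv> haros_graph (farey_path a j)"

lemma wf_path_graph: "path_letter a 0 = L \<Longrightarrow> wf_ograph (path_graph a j)"
  using farey_path_neighbours(1) farey_level_subset_upto wf_haros_graph by blast

lemma path_graph_Suc_L:
  assumes "path_letter a 0 = L" and "path_letter a j = L"
  shows "path_graph a (Suc j) = ograph_concat (haros_graph (left_neighbour a j)) (path_graph a j)"
    and "wf_ograph (haros_graph (left_neighbour a j))"
  using farey_path_Suc_L[OF assms] farey_path_neighbours(2)[OF assms(1), of j]
    haros_graph_mediant wf_haros_graph
  by (auto simp: adjacent_in_def)

lemma path_graph_Suc_R: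
  assumes "path_letter a 0 = L" and "path_letter a j = R"
  shows "path_graph a (Suc j) = ograph_concat (path_graph a j) (haros_graph (right_neighbour a j))"
    and "wf_ograph (haros_graph (right_neighbour a j))"
  using farey_path_Suc_R[OF assms] farey_path_neighbours(3)[OF assms(1), of j]
    haros_graph_mediant wf_haros_graph
  by (auto simp: adjacent_in_def)

lemma last_degree_path_L:
  assumes "path_letter a 0 = L" and "path_letter a j = L"
  shows "last_degree (path_graph a (Suc j)) = last_degree (path_graph a j) + 1"
  unfolding path_graph_Suc_L(1)[OF assms]
  by (intro last_degree_concat path_graph_Suc_L(2) wf_path_graph assms)

lemma first_degree_path_R:
  assumes "path_letter a 0 = L" and "path_letter a j = R"
  shows "first_degree (path_graph a (Suc j)) = first_degree (path_graph a j) + 1"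
  unfolding path_graph_Suc_R(1)[OF assms]
  by (intro first_degree_concat path_graph_Suc_R(2) wf_path_graph assms)

text \<open>After the \<open>R\<close> step the vertex left behind is the left neighbour, so the
  \<open>L\<close> step joins two consecutive path graphs. Both steps raise the same first degree,
  that of graph \<open>j\<close>, by one.\<close>

lemma path_graph_RL:
  assumes "path_letter a 0 = L" and "path_letter a j = R" and "path_letter a (Suc j) = L"
  shows "path_graph a (Suc (Suc j)) = ograph_concat (path_graph a j) (path_graph a (Suc j))"
    and "first_degree (path_graph a (Suc (Suc j))) = first_degree (path_graph a (Suc j))"
proof -
  show eq: "path_graph a (Suc (Suc j)) = ograph_concat (path_graph a j) (path_graph a (Suc j))"
    using path_graph_Suc_L(1)[OF assms(1,3)] assms(2) by simp
  show "first_degree (path_graph a (Suc (Suc j))) = first_degree (path_graph a (Suc j))"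
    unfolding eq first_degree_path_R[OF assms(1,2)]
    by (intro first_degree_concat wf_path_graph assms)
qed

lemma path_graph_LR:
  assumes "path_letter a 0 = L" and "path_letter a j = L" and "path_letter a (Suc j) = R"
  shows "path_graph a (Suc (Suc j)) = ograph_concat (path_graph a (Suc j)) (path_graph a j)"
    and "last_degree (path_graph a (Suc (Suc j))) = last_degree (path_graph a (Suc j))"
proof -
  show eq: "path_graph a (Suc (Suc j)) = ograph_concat (path_graph a (Suc j)) (path_graph a j)"
    using path_graph_Suc_R(1)[OF assms(1,3)] assms(2) by simp
  show "last_degree (path_graph a (Suc (Suc j))) = last_degree (path_graph a (Suc j))"
    unfolding eq last_degree_path_L[OF assms(1,2)]
    by (intro last_degree_concat wf_path_graph assms)
qed

definition boundary_degree :: "ograph \<Rightarrow> nat" where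
  "boundary_degree G = first_degree G + last_degree G"

text \<open>The second letter raises the degree of one end by one; the turn leaves the other end
  unchanged.\<close>

lemma boundary_degree_alternating:
  assumes "path_letter a 0 = L" and "path_letter a j \<noteq> path_letter a (Suc j)"
  shows "boundary_degree (path_graph a (Suc (Suc j))) = boundary_degree (path_graph a (Suc j)) + 1"
proof (cases "path_letter a j")
  case L
  with assms(2) have R: "path_letter a (Suc j) = R" by (metis direction.exhaust)
  show ?thesis
    using path_graph_LR(2)[OF assms(1) L R] first_degree_path_R[OF assms(1) R]
    by (simp add: boundary_degree_def)
next
  case R
  with assms(2) have L: "path_letter a (Suc j) = L" by (metis direction.exhaust)
  show ?thesis
    using path_graph_RL(2)[OF assms(1) R L] last_degree_path_L[OF assms(1) L]
    by (simp add: boundary_degree_def)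
qed

text \<open>Counting nodes after merging the two ends absorbs the node shared in the concatenation
  and makes the Fibonacci recurrence exact.\<close>

lemma num_nodes_alternating:
  assumes "path_letter a 0 = L" and "path_letter a j \<noteq> path_letter a (Suc j)"
  shows "num_nodes (path_graph a (Suc (Suc j))) - 1 =
    (num_nodes (path_graph a (Suc j)) - 1) + (num_nodes (path_graph a j) - 1)"
proof -
  have "2 \<le> num_nodes (path_graph a j)" "2 \<le> num_nodes (path_graph a (Suc j))"
    using wf_path_graph[OF assms(1)] by (auto simp: wf_ograph_def)
  moreover have "num_nodes (path_graph a (Suc (Suc j))) =
      num_nodes (path_graph a (Suc j)) + num_nodes (path_graph a j) - 1"
    using assms(2) path_graph_LR(1)[OF assms(1)] path_graph_RL(1)[OF assms(1)]
    by (cases "path_letter a j"; cases "path_letter a (Suc j)")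
      (auto simp: num_nodes_concat)
  ultimately show ?thesis by simp
qed

text \<open>The new node merges an end of graph \<open>j + 1\<close> with an end of graph
  \<open>j + 2\<close>. The earlier turn gave the former the degree of the other end of graph
  \<open>j + 2\<close>, so the sum is a boundary degree. This is why two turns are required.\<close>

lemma interior_count_alternating:
  assumes "path_letter a 0 = L" and "path_letter a j \<noteq> path_letter a (Suc j)"
    and "path_letter a (Suc j) \<noteq> path_letter a (Suc (Suc j))"
  shows "interior_count k (path_graph a (Suc (Suc (Suc j)))) =
    interior_count k (path_graph a (Suc (Suc j))) + interior_count k (path_graph a (Suc j)) +
    (if k = boundary_degree (path_graph a (Suc (Suc j))) then 1 else 0)"
proof (cases "path_letter a j")
  case L
  with assms have R: "path_letter a (Suc j) = R" and L': "path_letter a (Suc (Suc j)) = L"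
    by (metis direction.exhaust)+
  show ?thesis
    unfolding path_graph_RL(1)[OF assms(1) R L']
    using interior_count_concat[OF wf_path_graph wf_path_graph, OF assms(1) assms(1)]
      path_graph_LR(2)[OF assms(1) L R]
    by (simp add: boundary_degree_def)
next
  case R
  with assms have L: "path_letter a (Suc j) = L" and R': "path_letter a (Suc (Suc j)) = R"
    by (metis direction.exhaust)+
  show ?thesis
    unfolding path_graph_LR(1)[OF assms(1) L R']
    using interior_count_concat[OF wf_path_graph wf_path_graph, OF assms(1) assms(1)]
      path_graph_RL(2)[OF assms(1) R L]
    by (simp add: boundary_degree_def)
qed


section \<open>Limits of quotients of Fibonacci-type sequences\<close>

section \<open>Fibonacci asymptotics\<close>

lemma fib_over_power_limit:
  "(\<lambda>n. real (fib n) / ((1 + sqrt 5) / 2) ^ n) \<longlonglongrightarrow> 1 / sqrt 5"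
proof -
  have "(\<lambda>n. real (fib n) / (((1 + sqrt 5) / 2) ^ n / sqrt 5) * (1 / sqrt 5)) \<longlonglongrightarrow> 1 * (1 / sqrt 5)"
    by (intro tendsto_mult fib_asymptotics tendsto_const)
  then show ?thesis by simp
qed

text \<open>Stating this at \<open>Suc i\<close> avoids the predecessor in
  \<open>fib (i - 1)\<close>.\<close>

lemma fib_recurrence_solution:
  fixes Q :: "nat \<Rightarrow> nat"
  assumes "\<And>i. Q (Suc (Suc i)) = Q (Suc i) + Q i"
  shows "Q (Suc i) = Q 1 * fib (Suc i) + Q 0 * fib i"
  by (induction i rule: fib.induct) (simp_all add: assms algebra_simps)

text \<open>The sequence is zero through index \<open>Suc t\<close>; the impulse then makes the next
  value 1, so the restart matches \<open>fib 0\<close> and \<open>fib 1\<close>.\<close>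

lemma fib_impulse_response:
  fixes N :: "nat \<Rightarrow> nat"
  assumes "N 0 = 0" and "N 1 = 0"
    and rec: "\<And>i. N (Suc (Suc i)) = N (Suc i) + N i + (if i = t then 1 else 0)"
  shows "N (i + Suc t) = fib i"
proof -
  have 0: "i \<le> Suc t \<Longrightarrow> N i = 0" for i
    by (induction i rule: fib.induct) (use assms in auto)
  show ?thesis
    by (induction i rule: fib.induct) (simp_all add: 0 rec)
qed

text \<open>Shift the index by \<open>Suc t\<close> and divide numerator and denominator by
  \<open>\<phi> ^ i\<close>: the factors \<open>sqrt 5\<close> cancel and the bounded term
  \<open>B\<close> disappears.\<close>

lemma fib_ratio_limit:
  fixes N Q B :: "nat \<Rightarrow> nat"
  defines "\<phi> \<equiv> (1 + sqrt 5) / 2"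
  assumes Q: "\<And>i. Q (Suc (Suc i)) = Q (Suc i) + Q i" "0 < Q 0"
    and N: "N 0 = 0" "N 1 = 0"
      "\<And>i. N (Suc (Suc i)) = N (Suc i) + N i + (if i = t then 1 else 0)"
    and B: "\<And>i. B i \<le> 1"
  shows "(\<lambda>i. real (N i + B i) / real (Q i)) \<longlonglongrightarrow> 1 / (real (Q 1) * \<phi> + real (Q 0)) * inverse \<phi> ^ t"
proof -
  have phi: "1 < \<phi>" by (simp add: \<phi>_def)
  then have phi0: "0 < \<phi>" by simp
  have fl: "(\<lambda>n. real (fib n) / \<phi> ^ n) \<longlonglongrightarrow> 1 / sqrt 5"
    unfolding \<phi>_def by (rule fib_over_power_limit)
  have Blim: "(\<lambda>i. real (B (i + Suc t)) / \<phi> ^ i) \<longlonglongrightarrow> 0"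
  proof (rule tendsto_sandwich[of "\<lambda>i. 0"])
    show "(\<lambda>i. inverse \<phi> ^ i) \<longlonglongrightarrow> 0"
      using phi by (intro LIMSEQ_power_zero) (simp add: field_simps)
    show "\<forall>\<^sub>F i in sequentially. real (B (i + Suc t)) / \<phi> ^ i \<le> inverse \<phi> ^ i"
      using B phi0 by (intro always_eventually allI) (simp add: field_simps)
    show "(\<lambda>i. 0 :: real) \<longlonglongrightarrow> 0" by simp
  qed (use phi0 in auto)
  have num: "(\<lambda>i. real (N (i + Suc t) + B (i + Suc t)) / \<phi> ^ i) \<longlonglongrightarrow> 1 / sqrt 5 + 0"
    using tendsto_add[OF fl Blim] by (simp only: fib_impulse_response[OF N] add_divide_distrib of_nat_add)
  \<comment> \<open>Each Fibonacci term is normalised by its own power of \<open>\<phi>\<close>; the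
    outer factors \<open>\<phi> ^ Suc t\<close> and \<open>\<phi> ^ t\<close> compensate for the
    shifts.\<close>
  have "(\<lambda>i. real (Q 1) * \<phi> ^ Suc t * (real (fib (i + Suc t)) / \<phi> ^ (i + Suc t)) +
      real (Q 0) * \<phi> ^ t * (real (fib (i + t)) / \<phi> ^ (i + t)))
    \<longlonglongrightarrow> real (Q 1) * \<phi> ^ Suc t * (1 / sqrt 5) + real (Q 0) * \<phi> ^ t * (1 / sqrt 5)"
    by (intro tendsto_add tendsto_mult tendsto_const LIMSEQ_ignore_initial_segment fl)
  moreover have "real (Q 1) * \<phi> ^ Suc t * (real (fib (i + Suc t)) / \<phi> ^ (i + Suc t)) +
      real (Q 0) * \<phi> ^ t * (real (fib (i + t)) / \<phi> ^ (i + t)) = real (Q (i + Suc t)) / \<phi> ^ i" for i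
  proof -
    have "real (Q (i + Suc t)) = real (Q 1) * real (fib (i + Suc t)) + real (Q 0) * real (fib (i + t))"
      using fib_recurrence_solution[of Q "i + t", OF Q(1)] by simp
    then show ?thesis using phi0 by (simp add: power_add field_simps del: fib.simps)
  qed
  ultimately have den: "(\<lambda>i. real (Q (i + Suc t)) / \<phi> ^ i)
      \<longlonglongrightarrow> real (Q 1) * \<phi> ^ Suc t * (1 / sqrt 5) + real (Q 0) * \<phi> ^ t * (1 / sqrt 5)"
    by simp
  have pos: "0 < real (Q 1) * \<phi> + real (Q 0)"
    using Q(2) phi0 by (simp add: add_nonneg_pos)
  have den_eq: "real (Q 1) * \<phi> ^ Suc t * (1 / sqrt 5) + real (Q 0) * \<phi> ^ t * (1 / sqrt 5)
      = \<phi> ^ t * (real (Q 1) * \<phi> + real (Q 0)) / sqrt 5"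
    by (simp add: field_simps)
  have "(\<lambda>i. real (N (i + Suc t) + B (i + Suc t)) / real (Q (i + Suc t)))
      \<longlonglongrightarrow> (1 / sqrt 5 + 0) / (\<phi> ^ t * (real (Q 1) * \<phi> + real (Q 0)) / sqrt 5)"
    using tendsto_divide[OF num den[unfolded den_eq]] pos phi0 by simp
  also have "(1 / sqrt 5 + 0) / (\<phi> ^ t * (real (Q 1) * \<phi> + real (Q 0)) / sqrt 5)
      = 1 / (real (Q 1) * \<phi> + real (Q 0)) * inverse \<phi> ^ t"
    by (simp add: field_simps)
  finally show ?thesis by (rule LIMSEQ_offset)
qed


section \<open>Assembling the limit for an eventually alternating path\<close>

section \<open>Noble numbers\<close>

theorem theorem3:
  fixes x :: real
  assumes "0 < x" and "x < 1" and "noble x"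
  shows "\<exists>C>0. \<exists>k0. \<forall>k\<ge>k0.
    convergent (\<lambda>j. P_rat k (symbolic_path x j)) \<and>
    P_irrat k x = C * (inverse ((1 + sqrt 5) / 2)) ^ k"
proof -
  define \<phi> :: real where "\<phi> = (1 + sqrt 5) / 2"
  have phi0: "0 < \<phi>" by (simp add: \<phi>_def add_pos_pos)
  obtain a m where irr: "x \<notin> \<rat>" and a: "cf_expansion a x" and ones: "\<And>i. m \<le> i \<Longrightarrow> a i = 1"
    using assms(3) unfolding noble_def by blast
  have a0: "path_letter a 0 = L" using a by (simp add: cf_expansion_def path_letter_0)
  define S where "S = (\<Sum>t<m. a t)"
  \<comment> \<open>Letters alternate from position \<open>S\<close>; starting one vertex later
    makes a turn available before every recurrence, already at \<open>i = 0\<close>.\<close>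
  define G where "G i = path_graph a (Suc (S + i))" for i
  have wf: "wf_ograph (G i)" for i
    unfolding G_def by (rule wf_path_graph[OF a0])
  have alt: "path_letter a (S + i) \<noteq> path_letter a (Suc (S + i))" for i
    using path_letter_tail[of m a i, OF ones] path_letter_tail[of m a "Suc i", OF ones]
    by (simp add: S_def)
  have "boundary_degree (G (Suc i)) = boundary_degree (G i) + 1" for i
    using boundary_degree_alternating[OF a0 alt, of i] by (simp add: G_def)
  then have D: "boundary_degree (G (Suc i)) = boundary_degree (G 0) + Suc i" for i
    by (induction i) simp_all
  define Q where "Q i = num_nodes (G i) - 1" for i
  have Q: "Q (Suc (Suc i)) = Q (Suc i) + Q i" for i
    using num_nodes_alternating[OF a0 alt, of "Suc i"] by (simp add: Q_def G_def)
  have Q0: "0 < Q 0" using wf[of 0] by (simp add: Q_def wf_ograph_def)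
  have I: "interior_count k (G (Suc (Suc i))) = interior_count k (G (Suc i)) + interior_count k (G i)
      + (if k = boundary_degree (G (Suc i)) then 1 else 0)" for k i
    using interior_count_alternating[OF a0 alt, of i k] alt[of "Suc i"]
    by (simp add: G_def)
  \<comment> \<open>Now \<open>G (Suc i)\<close> has boundary degree \<open>d + i\<close>, so for
    \<open>k = d + t\<close> the impulse comes at \<open>i = t\<close>. The factor
    \<open>\<phi> ^ d\<close> in \<open>C\<close> converts the exponent \<open>t\<close> into
    \<open>k\<close>.\<close>
  define d where "d = Suc (boundary_degree (G 0))"
  define C where "C = 1 / (real (Q 1) * \<phi> + real (Q 0)) * \<phi> ^ d"
  have Cpos: "0 < C"
    using Q0 phi0 by (simp add: C_def add_nonneg_pos)
  \<comment> \<open>Large enough that \<open>k - d\<close> is not truncated and that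
    \<open>k\<close> exceeds the edge numbers of both initial graphs, whose counts are then
    zero.\<close>
  define k0 where "k0 = d + card (edges (G 0)) + card (edges (G 1)) + 1"
  have lim: "(\<lambda>j. P_rat k (symbolic_path x j)) \<longlonglongrightarrow> C * inverse \<phi> ^ k" if k: "k0 \<le> k" for k
  proof -
    define t where "t = k - d"
    have kt: "k = d + t" using k by (simp add: t_def k0_def)
    define N where "N i = interior_count k (G i)" for i
    \<comment> \<open>The contribution of the merged boundary node, at most one for each
      graph.\<close>
    define B :: "nat \<Rightarrow> nat" where "B i = (if k = boundary_degree (G i) then 1 else 0)" for i
    have "k = boundary_degree (G (Suc i)) \<longleftrightarrow> i = t" for i
      using D[of i] kt by (auto simp: d_def)
    then have "N (Suc (Suc i)) = N (Suc i) + N i + (if i = t then 1 else 0)" for i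
      unfolding N_def I by simp
    moreover have "N 0 = 0" "N 1 = 0"
      unfolding N_def using k by (auto intro!: interior_count_eq_0 wf simp: k0_def)
    moreover have "B i \<le> 1" for i by (simp add: B_def)
    ultimately have "(\<lambda>i. real (N i + B i) / real (Q i))
        \<longlonglongrightarrow> 1 / (real (Q 1) * \<phi> + real (Q 0)) * inverse \<phi> ^ t"
      unfolding \<phi>_def using Q Q0 by (intro fib_ratio_limit) auto
    moreover have "1 / (real (Q 1) * \<phi> + real (Q 0)) * inverse \<phi> ^ t = C * inverse \<phi> ^ k"
      using phi0 by (simp add: C_def kt power_add power_inverse)
    moreover have "real (N i + B i) / real (Q i) = P_rat k (symbolic_path x (i + Suc S))" for i
      using degree_fraction_eq[OF wf[of i], of k]
      by (simp add: P_rat_def symbolic_path_def cf_of_eq[OF a irr] N_def B_def Q_def G_def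
          boundary_degree_def add.commute)
    ultimately have "(\<lambda>i. P_rat k (symbolic_path x (i + Suc S))) \<longlonglongrightarrow> C * inverse \<phi> ^ k"
      by simp
    then show ?thesis by (rule LIMSEQ_offset)
  qed
  show ?thesis
    using Cpos lim unfolding P_irrat_def convergent_def \<phi>_def by (blast intro: limI)
qed

end
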